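(* Let $\kappa\ge2$ and let $K:[0,1]^2\to[0,\infty)$ be a symmetric kernel with $K\in L^1([0,1]^2,dx)$. For every $c>0$ and $0<\delta<1/2$ one can choose $M=M(c)$ such that, for all $N$ sufficiently large, $$\Big|\mathbb E\Big[\frac{\mathsf{MaxCut}_\kappa(G_N)}N\Big]-\mathbb E\Big[\frac{\mathsf{MaxCut}_\kappa(\tilde G_N)}N\Big]\Big|\le c^{1/2-\delta},$$ where $G_N$ is the random graph with parameter $c$ generated from the kernel $K$ and $\tilde G_N$ is the random graph with parameter $c$ generated from the coarsened kernel $$K_1(x,y)=M^2\sum_{i,j=1}^M\mathbf 1\Big(x\in\Big[\tfrac{i-1}M,\tfrac iM\Big],\,y\in\Big[\tfrac{j-1}M,\tfrac jM\Big]\Big)\int_{[\frac{i-1}M,\frac iM]\times[\frac{j-1}M,\frac jM]}K(s,t)\,ds\,dt .$$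
   Context: For a symmetric integrable kernel $L:[0,1]^2\to[0,\infty)$ and $c>0$, the random graph on vertex set $[N]$ generated from $L$ with parameter $c$ has independent edges, with $\{i,j\}$ an edge with probability $\min\{c\tilde L_N(i,j)/N,1\}$, where $\tilde L_N(i,j)=N^2\int_{[\frac{i-1}N,\frac iN]\times[\frac{j-1}N,\frac jN]}L(x,y)\,dx\,dy$. For a graph $G$ on $[N]$ with adjacency matrix $(A_{i,j})$, $\mathsf{MaxCut}_\kappa(G)=\frac12\max_{\sigma\in[\kappa]^N}\sum_{i,j=1}^NA_{i,j}\mathbf 1(\sigma_i\ne\sigma_j)$. *)

theory Defs
  imports "HOL-Probability.Probability" "HOL-Probability.Product_PMF"
begin

text \<open>
  Kernels are functions on the whole plane; only their values on the unit square are ever used.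
\<close>

definition graph_kernel :: "(real \<times> real \<Rightarrow> real) \<Rightarrow> bool" where
  "graph_kernel K \<longleftrightarrow>
     (\<forall>x\<in>{0..1}. \<forall>y\<in>{0..1}. 0 \<le> K (x, y) \<and> K (x, y) = K (y, x)) \<and>
     set_integrable lebesgue ({0..1} \<times> {0..1}) K"

definition cell :: "nat \<Rightarrow> nat \<Rightarrow> nat \<Rightarrow> (real \<times> real) set" where
  "cell m i j = {(real i - 1) / real m .. real i / real m} \<times> {(real j - 1) / real m .. real j / real m}"

definition cell_average :: "(real \<times> real \<Rightarrow> real) \<Rightarrow> nat \<Rightarrow> nat \<Rightarrow> nat \<Rightarrow> real" where
  "cell_average L N i j = (real N)\<^sup>2 * (LINT z:cell N i j|lebesgue. L z)"

definition coarsened_kernel :: "nat \<Rightarrow> (real \<times> real \<Rightarrow> real) \<Rightarrow> real \<times> real \<Rightarrow> real" where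
  "coarsened_kernel M K z =
     (real M)\<^sup>2 * (\<Sum>i=1..M. \<Sum>j=1..M. indicator (cell M i j) z * (LINT w:cell M i j|lebesgue. K w))"

definition edge_prob :: "real \<Rightarrow> (real \<times> real \<Rightarrow> real) \<Rightarrow> nat \<Rightarrow> nat \<Rightarrow> nat \<Rightarrow> real" where
  "edge_prob c L N i j = min (c * cell_average L N i j / real N) 1"

definition vertex_pairs :: "nat \<Rightarrow> (nat \<times> nat) set" where
  "vertex_pairs N = {(i, j). 1 \<le> i \<and> i < j \<and> j \<le> N}"

text \<open>
  A graph on the vertex set \<open>{1..N}\<close> is represented by its set of edges \<open>{i, j}\<close> with \<open>i \<noteq> j\<close>.
  Each unordered pair of vertices is indexed by its increasing enumeration, so that every
  potential edge receives exactly one of the independent Bernoulli variables.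
\<close>

definition random_graph :: "real \<Rightarrow> (real \<times> real \<Rightarrow> real) \<Rightarrow> nat \<Rightarrow> nat set set pmf" where
  "random_graph c L N =
     map_pmf (\<lambda>X. {{i, j} | i j. (i, j) \<in> vertex_pairs N \<and> X (i, j)})
       (Pi_pmf (vertex_pairs N) False (\<lambda>(i, j). bernoulli_pmf (edge_prob c L N i j)))"

definition adjacency :: "nat set set \<Rightarrow> nat \<Rightarrow> nat \<Rightarrow> real" where
  "adjacency G i j = of_bool ({i, j} \<in> G)"

definition max_cut :: "nat \<Rightarrow> nat \<Rightarrow> nat set set \<Rightarrow> real" where
  "max_cut \<kappa> N G = 1 / 2 *
     Max ((\<lambda>\<sigma>. \<Sum>i=1..N. \<Sum>j=1..N. adjacency G i j * of_bool (\<sigma> i \<noteq> \<sigma> j)) ` ({1..N} \<rightarrow>\<^sub>E {1..\<kappa>}))"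

end

theory Submission
  imports Defs
begin

text \<open>
  Flipping one edge changes the maximum cut by at most one, so replacing the independent edges one
  at a time shows that the two expected maximum cuts differ by at most the sum of
  \<open>\<bar>p\<^sub>i\<^sub>j - q\<^sub>i\<^sub>j\<bar>\<close> over the edge probabilities. After division by \<open>N\<close> this is at most \<open>c\<close> times the
  \<open>L\<^sup>1\<close> distance of the kernels, uniformly in \<open>N\<close>. The block averages of \<open>K\<close> converge to \<open>K\<close> in \<open>L\<^sup>1\<close>
  because they do so for continuous functions, which are dense.
\<close>

section \<open>Lipschitz functions of independent Bernoulli variables\<close>

text \<open>Conditioning on one coordinate \<open>a\<close> writes each expectation as a mixture of
  the expectations of the two sections of \<open>F\<close> at \<open>a\<close>. The remaining
  coordinates are exchanged by induction inside each section, and exchanging \<open>p a\<close> for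
  \<open>q a\<close> costs at most \<open>L * \<bar>p a - q a\<bar>\<close>. The induction runs over
  arbitrary \<open>F\<close> so that it applies to the sections, which inherit the Lipschitz
  bound.\<close>

lemma expectation_Pi_pmf_bernoulli_diff_le:
  fixes p q :: "'a \<Rightarrow> real" and F :: "('a \<Rightarrow> bool) \<Rightarrow> real"
  assumes "finite A"
    and p: "\<And>x. x \<in> A \<Longrightarrow> p x \<in> {0..1}" and q: "\<And>x. x \<in> A \<Longrightarrow> q x \<in> {0..1}"
    and lip: "\<And>X x. x \<in> A \<Longrightarrow> \<bar>F (X(x := True)) - F (X(x := False))\<bar> \<le> L"
  shows "\<bar>measure_pmf.expectation (Pi_pmf A False (\<lambda>x. bernoulli_pmf (p x))) F
      - measure_pmf.expectation (Pi_pmf A False (\<lambda>x. bernoulli_pmf (q x))) F\<bar>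
    \<le> L * (\<Sum>x\<in>A. \<bar>p x - q x\<bar>)"
  using assms
proof (induction A arbitrary: F rule: finite_induct)
  case empty
  then show ?case by simp
next
  case (insert a A)
  \<comment> \<open>Finite support makes every real function integrable and turns the expectation of
    the bind below into a finite sum.\<close>
  have fin: "finite (set_pmf (Pi_pmf A False (\<lambda>x. bernoulli_pmf (r x))))" for r
    by (rule finite_subset[OF set_Pi_pmf_subset'[OF insert.hyps(1)]])
       (intro finite_PiE_dflt, use insert.hyps in auto)
  define E where "E r G = measure_pmf.expectation (Pi_pmf A False (\<lambda>x. bernoulli_pmf (r x))) G"
    for r and G :: "('a \<Rightarrow> bool) \<Rightarrow> real"
  let ?T = "\<lambda>f. F (f(a := True))" and ?N = "\<lambda>f. F (f(a := False))"
  have step: "measure_pmf.expectation (Pi_pmf (insert a A) False (\<lambda>x. bernoulli_pmf (r x))) F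
      = r a * E r ?T + (1 - r a) * E r ?N" if "r a \<in> {0..1}" for r
  proof -
    have "measure_pmf.expectation (Pi_pmf (insert a A) False (\<lambda>x. bernoulli_pmf (r x))) F
       = measure_pmf.expectation (bernoulli_pmf (r a))
         (\<lambda>y. measure_pmf.expectation (Pi_pmf A False (\<lambda>x. bernoulli_pmf (r x))) (\<lambda>f. F (f(a := y))))"
      unfolding Pi_pmf_insert'[OF insert.hyps]
      by (subst pmf_expectation_bind[where A = UNIV], simp, use fin in simp, simp)
         (simp flip: map_pmf_def add: integral_measure_pmf[where A = UNIV])
    also have "\<dots> = r a * E r ?T + (1 - r a) * E r ?N"
      using that by (simp add: E_def mult.commute)
    finally show ?thesis .
  qed
  have int: "integrable (Pi_pmf A False (\<lambda>x. bernoulli_pmf (r x))) (G :: _ \<Rightarrow> real)" for r G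
    by (rule integrable_measure_pmf_finite[OF fin])
  have IH: "\<bar>E p G - E q G\<bar> \<le> L * (\<Sum>x\<in>A. \<bar>p x - q x\<bar>)"
    if "\<And>X x. x \<in> A \<Longrightarrow> \<bar>G (X(x := True)) - G (X(x := False))\<bar> \<le> L" for G
    unfolding E_def
  proof (rule insert.IH)
    show "p x \<in> {0..1}" "q x \<in> {0..1}" if "x \<in> A" for x
      using insert.prems that by blast+
  qed (rule that)
  have T: "\<bar>E p ?T - E q ?T\<bar> \<le> L * (\<Sum>x\<in>A. \<bar>p x - q x\<bar>)"
  proof (rule IH)
    fix X x assume "x \<in> A"
    \<comment> \<open>Since the coordinates differ, the two updates commute, and the Lipschitz
      hypothesis can be used at the point \<open>X(a := True)\<close>.\<close>
    then have "x \<noteq> a" using insert.hyps by auto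
    then show "\<bar>?T (X(x := True)) - ?T (X(x := False))\<bar> \<le> L"
      using insert.prems(3)[of x "X(a := True)"] \<open>x \<in> A\<close> by (simp add: fun_upd_twist[of x a] del: fun_upd_apply)
  qed
  have N: "\<bar>E p ?N - E q ?N\<bar> \<le> L * (\<Sum>x\<in>A. \<bar>p x - q x\<bar>)"
  proof (rule IH)
    fix X x assume "x \<in> A"
    then have "x \<noteq> a" using insert.hyps by auto
    then show "\<bar>?N (X(x := True)) - ?N (X(x := False))\<bar> \<le> L"
      using insert.prems(3)[of x "X(a := False)"] \<open>x \<in> A\<close> by (simp add: fun_upd_twist[of x a] del: fun_upd_apply)
  qed
  have TN: "\<bar>E q ?T - E q ?N\<bar> \<le> L"
  proof -
    have "\<bar>E q ?T - E q ?N\<bar> = \<bar>E q (\<lambda>f. ?T f - ?N f)\<bar>"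
      unfolding E_def by (subst Bochner_Integration.integral_diff) (auto intro: int)
    also have "\<dots> \<le> E q (\<lambda>f. \<bar>?T f - ?N f\<bar>)"
      unfolding E_def by (rule integral_abs_bound)
    also have "\<dots> \<le> E q (\<lambda>f. L)"
      unfolding E_def by (intro integral_mono int insert.prems(3) insertI1)
    finally show ?thesis by (simp add: E_def)
  qed
  have pa: "0 \<le> p a" "p a \<le> 1" using insert.prems(1)[of a] by auto
  \<comment> \<open>The regrouping passes through the mixture with weight \<open>p a\<close> but the
    law \<open>q\<close> on \<open>A\<close>: first the law on \<open>A\<close> changes within each
    section, then the weight of \<open>a\<close> changes.\<close>
  have "\<bar>(p a * E p ?T + (1 - p a) * E p ?N) - (q a * E q ?T + (1 - q a) * E q ?N)\<bar>
    = \<bar>p a * (E p ?T - E q ?T) + (1 - p a) * (E p ?N - E q ?N) + (p a - q a) * (E q ?T - E q ?N)\<bar>"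
    by (simp add: algebra_simps)
  also have "\<dots> \<le> p a * \<bar>E p ?T - E q ?T\<bar> + (1 - p a) * \<bar>E p ?N - E q ?N\<bar> + \<bar>p a - q a\<bar> * \<bar>E q ?T - E q ?N\<bar>"
    using pa by (auto simp: abs_mult intro!: order.trans[OF abs_triangle_ineq] add_mono)
  also have "\<dots> \<le> p a * (L * (\<Sum>x\<in>A. \<bar>p x - q x\<bar>)) + (1 - p a) * (L * (\<Sum>x\<in>A. \<bar>p x - q x\<bar>)) + \<bar>p a - q a\<bar> * L"
    using pa T N TN by (intro add_mono mult_left_mono) auto
  also have "\<dots> = L * (\<Sum>x\<in>insert a A. \<bar>p x - q x\<bar>)"
    using insert.hyps by (simp add: algebra_simps)
  finally show ?case using insert.prems by (simp add: step)
qed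

section \<open>Sensitivity of the maximum cut to single edges\<close>

text \<open>For each fixed colouring the cut weights differ by at most the summed change of the
  adjacency entries, and this uniform bound passes to the maxima. At least one colour is required
  for the set of colourings to be nonempty, so that \<open>Max\<close> is attained.\<close>

lemma max_cut_diff_le:
  assumes "\<kappa> \<ge> 1"
  shows "\<bar>max_cut \<kappa> N G - max_cut \<kappa> N H\<bar>
    \<le> 1 / 2 * (\<Sum>i=1..N. \<Sum>j=1..N. \<bar>adjacency G i j - adjacency H i j\<bar>)"
proof -
  define S where "S = {1..N} \<rightarrow>\<^sub>E {1..\<kappa>}"
  define cut where "cut G \<sigma> = (\<Sum>i=1..N. \<Sum>j=1..N. adjacency G i j * of_bool (\<sigma> i \<noteq> \<sigma> j))"
    for G and \<sigma> :: "nat \<Rightarrow> nat"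
  have fin: "finite S" unfolding S_def by (intro finite_PiE) auto
  have ne: "S \<noteq> {}" unfolding S_def using assms by (simp add: PiE_eq_empty_iff)
  have diff: "cut G \<sigma> - cut H \<sigma> \<le> (\<Sum>i=1..N. \<Sum>j=1..N. \<bar>adjacency G i j - adjacency H i j\<bar>)" for G H \<sigma>
    unfolding cut_def sum_subtractf[symmetric] by (intro sum_mono) (auto simp: of_bool_def)
  have "Max (cut G ` S) \<le> Max (cut H ` S) + (\<Sum>i=1..N. \<Sum>j=1..N. \<bar>adjacency G i j - adjacency H i j\<bar>)" for G H
  proof (rule Max.boundedI)
    fix v assume "v \<in> cut G ` S"
    then obtain \<sigma> where "\<sigma> \<in> S" "v = cut G \<sigma>" by auto
    moreover have "cut H \<sigma> \<le> Max (cut H ` S)" using fin \<open>\<sigma> \<in> S\<close> by simp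
    ultimately show "v \<le> Max (cut H ` S) + (\<Sum>i=1..N. \<Sum>j=1..N. \<bar>adjacency G i j - adjacency H i j\<bar>)"
      using diff[of G \<sigma> H] by linarith
  qed (use fin ne in auto)
  from this[of G H] this[of H G]
  have "Max (cut G ` S) \<le> Max (cut H ` S) + (\<Sum>i=1..N. \<Sum>j=1..N. \<bar>adjacency G i j - adjacency H i j\<bar>)"
    "Max (cut H ` S) \<le> Max (cut G ` S) + (\<Sum>i=1..N. \<Sum>j=1..N. \<bar>adjacency G i j - adjacency H i j\<bar>)"
    by (simp_all add: abs_minus_commute)
  then show ?thesis
    unfolding max_cut_def cut_def[symmetric] S_def[symmetric] by linarith
qed

lemma finite_vertex_pairs [simp]: "finite (vertex_pairs N)"
  by (rule finite_subset[of _ "{1..N} \<times> {1..N}"]) (auto simp: vertex_pairs_def)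

text \<open>An edge occurs in the double sum as two ordered pairs, and the factor 1/2 in
  \<open>max_cut\<close> compensates for this.\<close>

lemma max_cut_toggle_edge_le:
  fixes N :: nat
  assumes "\<kappa> \<ge> 1"
  defines "edges X \<equiv> {{i, j} | i j. (i, j) \<in> vertex_pairs N \<and> X (i, j)}"
  shows "\<bar>max_cut \<kappa> N (edges (X(e := True))) - max_cut \<kappa> N (edges (X(e := False)))\<bar> \<le> 1"
proof -
  obtain a b where e: "e = (a, b)" by force
  have adj: "\<bar>adjacency (edges (X(e := True))) i j - adjacency (edges (X(e := False))) i j\<bar>
      \<le> of_bool (i = a \<and> j = b) + of_bool (i = b \<and> j = a)" for i j
  proof (cases "{i, j} = {a, b}")
    case False
    then have "{i, j} \<in> edges (X(e := True)) \<longleftrightarrow> {i, j} \<in> edges (X(e := False))"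
      unfolding edges_def e by auto
    then show ?thesis by (simp add: adjacency_def)
  next
    case True
    then have "i = a \<and> j = b \<or> i = b \<and> j = a"
      by (simp add: doubleton_eq_iff)
    \<comment> \<open>Only a lower bound is claimed, because both indicators equal 1 when
      \<open>a = b\<close>.\<close>
    then have "1 \<le> (of_bool (i = a \<and> j = b) + of_bool (i = b \<and> j = a) :: real)"
      by (auto simp del: of_bool_conj)
    moreover have "\<bar>adjacency (edges (X(e := True))) i j - adjacency (edges (X(e := False))) i j\<bar> \<le> 1"
      by (simp add: adjacency_def of_bool_def)
    ultimately show ?thesis by linarith
  qed
  have "(\<Sum>i=1..N. \<Sum>j=1..N. \<bar>adjacency (edges (X(e := True))) i j - adjacency (edges (X(e := False))) i j\<bar>)
    \<le> (\<Sum>i=1..N. \<Sum>j=1..N. of_bool (i = a \<and> j = b) + of_bool (i = b \<and> j = a))"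
    by (intro sum_mono adj)
  also have "\<dots> = (\<Sum>z\<in>{1..N} \<times> {1..N}. of_bool (z = (a, b))) + (\<Sum>z\<in>{1..N} \<times> {1..N}. of_bool (z = (b, a)))"
    unfolding sum.cartesian_product sum.distrib[symmetric] by (intro sum.cong) auto
  \<comment> \<open>Each sum is 1 or 0, the latter when the point lies outside
    \<open>{1..N} \<times> {1..N}\<close>.\<close>
  also have "\<dots> \<le> 1 + 1"
    unfolding of_bool_def by (intro add_mono) (subst sum.delta; simp)+
  finally show ?thesis
    using max_cut_diff_le[OF assms(1), of N "edges (X(e := True))" "edges (X(e := False))"] by simp
qed

text \<open>The maximum cut over \<open>N\<close> is a function of the edge indicators with
  Lipschitz constant \<open>1 / N\<close>. The \<open>min\<close> in \<open>edge_prob\<close> bounds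
  it by 1, so nonnegativity places it in the range of Bernoulli parameters.\<close>

lemma expectation_max_cut_diff_le:
  assumes "\<kappa> \<ge> 1"
    and nonneg: "\<And>i j. (i, j) \<in> vertex_pairs N \<Longrightarrow> 0 \<le> edge_prob c K N i j"
      "\<And>i j. (i, j) \<in> vertex_pairs N \<Longrightarrow> 0 \<le> edge_prob c L N i j"
  shows "\<bar>measure_pmf.expectation (random_graph c K N) (\<lambda>G. max_cut \<kappa> N G / real N)
      - measure_pmf.expectation (random_graph c L N) (\<lambda>G. max_cut \<kappa> N G / real N)\<bar>
    \<le> 1 / real N * (\<Sum>(i, j)\<in>vertex_pairs N. \<bar>edge_prob c K N i j - edge_prob c L N i j\<bar>)"
proof -
  define F where "F X = max_cut \<kappa> N {{i, j} | i j. (i, j) \<in> vertex_pairs N \<and> X (i, j)} / real N" for X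
  have E: "measure_pmf.expectation (random_graph c L N) (\<lambda>G. max_cut \<kappa> N G / real N)
    = measure_pmf.expectation (Pi_pmf (vertex_pairs N) False (\<lambda>e. bernoulli_pmf (case e of (i, j) \<Rightarrow> edge_prob c L N i j))) F" for L
    unfolding random_graph_def F_def by (simp add: case_prod_unfold)
  have "\<bar>measure_pmf.expectation (random_graph c K N) (\<lambda>G. max_cut \<kappa> N G / real N)
      - measure_pmf.expectation (random_graph c L N) (\<lambda>G. max_cut \<kappa> N G / real N)\<bar>
    \<le> 1 / real N * (\<Sum>e\<in>vertex_pairs N. \<bar>(case e of (i, j) \<Rightarrow> edge_prob c K N i j) - (case e of (i, j) \<Rightarrow> edge_prob c L N i j)\<bar>)"
    unfolding E
  proof (rule expectation_Pi_pmf_bernoulli_diff_le)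
    show "\<bar>F (X(e := True)) - F (X(e := False))\<bar> \<le> 1 / real N" for X e
      unfolding F_def diff_divide_distrib[symmetric] abs_divide
      using max_cut_toggle_edge_le[OF assms(1), of N X e] by (simp add: divide_right_mono)
    show "(case e of (i, j) \<Rightarrow> edge_prob c K N i j) \<in> {0..1}" if "e \<in> vertex_pairs N" for e
      using nonneg(1) that by (cases e) (auto simp: edge_prob_def)
    show "(case e of (i, j) \<Rightarrow> edge_prob c L N i j) \<in> {0..1}" if "e \<in> vertex_pairs N" for e
      using nonneg(2) that by (cases e) (auto simp: edge_prob_def)
  qed simp
  then show ?thesis by (simp add: case_prod_unfold)
qed

section \<open>Density of continuous functions in \<open>L\<^sup>1\<close>\<close>

text \<open>Two approximations, each with error below \<open>e / 2\<close>. Clamping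
  \<open>f\<close> to \<open>[-n, n]\<close> is handled by dominated convergence. The clamped
  function is then approximated by clamped continuous functions that converge almost everywhere; on
  a set of finite measure their common bound is an integrable majorant.\<close>

lemma L1_dense_continuous:
  fixes f :: "'a::euclidean_space \<Rightarrow> real"
  assumes S: "S \<in> lmeasurable" and f: "integrable (lebesgue_on S) f" and "e > 0"
  obtains g where "continuous_on UNIV g" "integrable (lebesgue_on S) g"
    "(\<integral>x. \<bar>f x - g x\<bar> \<partial>lebesgue_on S) < e"
proof -
  interpret finite_measure "lebesgue_on S"
    using S by (rule finite_measure_lebesgue_on)
  define cut where "cut n v = max (- real n) (min (real n) v)" for n and v :: real
  have cut_le: "\<bar>cut n v\<bar> \<le> real n" "\<bar>v - cut n v\<bar> \<le> \<bar>v\<bar>" for n v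
    by (auto simp: cut_def)
  have [measurable]: "f \<in> borel_measurable (lebesgue_on S)"
    using f by (rule borel_measurable_integrable)
  have cut_meas [measurable]: "cut n \<in> borel_measurable borel" for n
    unfolding cut_def by measurable
  have "(\<lambda>n. \<integral>x. \<bar>f x - cut n (f x)\<bar> \<partial>lebesgue_on S) \<longlonglongrightarrow> (\<integral>x. 0 \<partial>lebesgue_on S)"
  proof (rule integral_dominated_convergence[where w = "\<lambda>x. \<bar>f x\<bar>"])
    show "AE x in lebesgue_on S. (\<lambda>n. \<bar>f x - cut n (f x)\<bar>) \<longlonglongrightarrow> 0"
    proof (rule AE_I2, rule tendsto_eventually)
      fix x
      obtain n0 where "\<bar>f x\<bar> \<le> real n0" using real_arch_simple by blast
      then have "\<bar>f x - cut n (f x)\<bar> = 0" if "n \<ge> n0" for n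
        using that by (auto simp: cut_def)
      then show "\<forall>\<^sub>F n in sequentially. \<bar>f x - cut n (f x)\<bar> = 0"
        unfolding eventually_sequentially by blast
    qed
  qed (use f cut_le in auto)
  then have "\<forall>\<^sub>F n in sequentially. (\<integral>x. \<bar>f x - cut n (f x)\<bar> \<partial>lebesgue_on S) < e / 2"
    using \<open>e > 0\<close> by (auto dest: order_tendstoD(2)[where a = "e / 2"])
  then obtain n where n: "(\<integral>x. \<bar>f x - cut n (f x)\<bar> \<partial>lebesgue_on S) < e / 2"
    by (auto simp: eventually_sequentially)
  \<comment> \<open>The definition of \<open>measurable_on\<close> supplies continuous functions
    that converge to \<open>f\<close> on \<open>S\<close> off a negligible set. They come with no
    common majorant, so they are clamped at the same level \<open>n\<close>, which keeps them
    continuous.\<close>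
  have "f measurable_on S"
    using S by (simp add: measurable_on_iff_borel_measurable fmeasurableD)
  then obtain N g where N: "negligible N" and g: "\<And>k. continuous_on UNIV (g k)"
    and lim: "\<And>x. x \<notin> N \<Longrightarrow> (\<lambda>k. g k x) \<longlonglongrightarrow> (if x \<in> S then f x else 0)"
    unfolding measurable_on_def by blast
  have cut_cont: "continuous_on UNIV (\<lambda>x. cut n (g k x))" for k
    unfolding cut_def by (intro continuous_intros g)
  have [measurable]: "(\<lambda>x. cut n (g k x)) \<in> borel_measurable (lebesgue_on S)" for k
    by (rule continuous_imp_measurable_on_sets_lebesgue)
       (use S in \<open>auto simp: fmeasurableD intro: continuous_on_subset[OF cut_cont]\<close>)
  have int_g: "integrable (lebesgue_on S) (\<lambda>x. cut n (g k x))" for k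
    by (rule integrable_const_bound[where B = "real n"]) (use cut_le in auto)
  have int_f: "integrable (lebesgue_on S) (\<lambda>x. cut n (f x))"
    by (rule integrable_const_bound[where B = "real n"]) (use cut_le in auto)
  have "(\<lambda>k. \<integral>x. \<bar>cut n (f x) - cut n (g k x)\<bar> \<partial>lebesgue_on S) \<longlonglongrightarrow> (\<integral>x. 0 \<partial>lebesgue_on S)"
  proof (rule integral_dominated_convergence[where w = "\<lambda>x. 2 * real n"])
    show "AE x in lebesgue_on S. norm \<bar>cut n (f x) - cut n (g k x)\<bar> \<le> 2 * real n" for k
    proof (rule AE_I2)
      fix x
      show "norm \<bar>cut n (f x) - cut n (g k x)\<bar> \<le> 2 * real n"
        using cut_le(1)[of n "f x"] cut_le(1)[of n "g k x"] by simp
    qed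
    have "AE x in lebesgue. x \<notin> N"
      using N by (intro AE_not_in) (simp add: negligible_iff_null_sets)
    then have "AE x in lebesgue_on S. x \<notin> N"
      using S by (subst AE_restrict_space_iff) (auto simp: fmeasurableD)
    then show "AE x in lebesgue_on S. (\<lambda>k. \<bar>cut n (f x) - cut n (g k x)\<bar>) \<longlonglongrightarrow> 0"
    proof (rule AE_mp, intro AE_I2 impI)
      fix x assume "x \<in> space (lebesgue_on S)" "x \<notin> N"
      then have "(\<lambda>k. g k x) \<longlonglongrightarrow> f x" using lim[of x] by simp
      then have "(\<lambda>k. \<bar>cut n (f x) - cut n (g k x)\<bar>) \<longlonglongrightarrow> \<bar>cut n (f x) - cut n (f x)\<bar>"
        unfolding cut_def by (intro tendsto_intros)
      then show "(\<lambda>k. \<bar>cut n (f x) - cut n (g k x)\<bar>) \<longlonglongrightarrow> 0" by simp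
    qed
  qed auto
  then have "\<forall>\<^sub>F k in sequentially. (\<integral>x. \<bar>cut n (f x) - cut n (g k x)\<bar> \<partial>lebesgue_on S) < e / 2"
    using \<open>e > 0\<close> by (auto dest: order_tendstoD(2)[where a = "e / 2"])
  then obtain k where k: "(\<integral>x. \<bar>cut n (f x) - cut n (g k x)\<bar> \<partial>lebesgue_on S) < e / 2"
    by (auto simp: eventually_sequentially)
  have "(\<integral>x. \<bar>f x - cut n (g k x)\<bar> \<partial>lebesgue_on S)
    \<le> (\<integral>x. \<bar>f x - cut n (f x)\<bar> + \<bar>cut n (f x) - cut n (g k x)\<bar> \<partial>lebesgue_on S)"
    by (rule integral_mono) (use f int_f int_g in auto)
  also have "\<dots> = (\<integral>x. \<bar>f x - cut n (f x)\<bar> \<partial>lebesgue_on S) + (\<integral>x. \<bar>cut n (f x) - cut n (g k x)\<bar> \<partial>lebesgue_on S)"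
    by (rule Bochner_Integration.integral_add) (use f int_f int_g in auto)
  also have "\<dots> < e" using n k by simp
  finally show ?thesis using that cut_cont int_g by blast
qed

section \<open>The division of the unit square into closed cells\<close>

lemma cell_eq_cbox:
  "cell m i j = cbox ((real i - 1) / real m, (real j - 1) / real m) (real i / real m, real j / real m)"
  by (auto simp: cell_def cbox_Pair_eq cbox_interval)

lemma cell_lmeasurable [simp]: "cell m i j \<in> lmeasurable" and cell_sets_lebesgue [simp]: "cell m i j \<in> sets lebesgue"
  by (simp_all add: cell_eq_cbox)

lemma measure_cell: "m \<ge> 1 \<Longrightarrow> measure lebesgue (cell m i j) = 1 / (real m)\<^sup>2"
  by (simp add: cell_eq_cbox content_Pair content_real divide_right_mono power2_eq_square
      flip: diff_divide_distrib)

lemma Union_cell: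
  assumes "m \<ge> 1"
  shows "(\<Union>(i, j)\<in>{1..m} \<times> {1..m}. cell m i j) = {0..1} \<times> {0..1}"
proof -
  have ex: "\<exists>i\<in>{1..m}. (real i - 1) / real m \<le> x \<and> x \<le> real i / real m" if "0 \<le> x" "x \<le> 1" for x
  proof (intro bexI conjI)
    \<comment> \<open>The ceiling of \<open>m * x\<close> is the right index except at
      \<open>x = 0\<close>, where it would be 0; the \<open>max\<close> moves that point into the
      first interval.\<close>
    define i where "i = max 1 (nat \<lceil>real m * x\<rceil>)"
    have mx: "0 \<le> real m * x" "real m * x \<le> real m" using that by (auto simp: mult_left_le)
    then have "nat \<lceil>real m * x\<rceil> \<le> m" by (simp add: nat_le_iff ceiling_le_iff)
    then show "i \<in> {1..m}" using assms by (auto simp: i_def)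
    have "real m * x \<le> real i" unfolding i_def by linarith
    then show "x \<le> real i / real m" using assms by (simp add: field_simps)
    have "real i - 1 \<le> real m * x" using mx unfolding i_def by (auto simp: max_def; linarith)
    then show "(real i - 1) / real m \<le> x" using assms by (simp add: field_simps)
  qed
  have sub: "0 \<le> (real i - 1) / real m" "real i / real m \<le> 1" if "i \<in> {1..m}" for i
    using that by auto
  show ?thesis
  proof (intro equalityI subsetI)
    fix z assume "z \<in> (\<Union>(i, j)\<in>{1..m} \<times> {1..m}. cell m i j)"
    then obtain i j where "i \<in> {1..m}" "j \<in> {1..m}" "z \<in> cell m i j" by auto
    then have "(real i - 1) / real m \<le> fst z" "fst z \<le> real i / real m"
      "(real j - 1) / real m \<le> snd z" "snd z \<le> real j / real m"
      by (auto simp: cell_def)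
    with sub[OF \<open>i \<in> {1..m}\<close>] sub[OF \<open>j \<in> {1..m}\<close>]
    have "0 \<le> fst z" "fst z \<le> 1" "0 \<le> snd z" "snd z \<le> 1" by linarith+
    then show "z \<in> {0..1} \<times> {0..1}" by (simp add: mem_Times_iff)
  next
    fix z :: "real \<times> real" assume z: "z \<in> {0..1} \<times> {0..1}"
    obtain x y where xy: "z = (x, y)" by force
    obtain i j where ij: "i \<in> {1..m}" "(real i - 1) / real m \<le> x" "x \<le> real i / real m"
      "j \<in> {1..m}" "(real j - 1) / real m \<le> y" "y \<le> real j / real m"
      using ex[of x] ex[of y] z xy by auto
    show "z \<in> (\<Union>(i, j)\<in>{1..m} \<times> {1..m}. cell m i j)"
      by (rule UN_I[of "(i, j)"]) (use ij in \<open>simp_all add: cell_def xy\<close>)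
  qed
qed

lemma cell_subset:
  assumes "i \<in> {1..m}" "j \<in> {1..m}"
  shows "cell m i j \<subseteq> {0..1} \<times> {0..1}"
proof -
  have "cell m i j \<subseteq> (\<Union>(i, j)\<in>{1..m} \<times> {1..m}. cell m i j)"
    using assms by blast
  also have "\<dots> = {0..1} \<times> {0..1}"
    using assms by (intro Union_cell) simp
  finally show ?thesis .
qed

text \<open>Closed cells can meet along edges or corners. The intersection lies in a rectangle that
  has no interior, because the two intervals overlap in at most a point in any coordinate where the
  indices differ.\<close>

lemma AE_cells_disjoint:
  assumes "m \<ge> 1" "(i, j) \<noteq> (i', j')"
  shows "AE z in lebesgue. \<not> (z \<in> cell m i j \<and> z \<in> cell m i' j')"
proof -
  \<comment> \<open>The endpoints of the intersection of two of the one-dimensional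
    intervals.\<close>
  define l u where "l i i' = max ((real i - 1) / real m) ((real i' - 1) / real m)"
    and "u i i' = min (real i / real m) (real i' / real m)" for i i'
  have le: "u i i' \<le> l i i'" if "i \<noteq> i'" for i i'
  proof (cases "i < i'")
    case True
    then have "real i / real m \<le> (real i' - 1) / real m" by (intro divide_right_mono) auto
    then show ?thesis by (simp add: u_def l_def min.coboundedI1 max.coboundedI2)
  next
    case False
    with that have "real i' / real m \<le> (real i - 1) / real m" by (intro divide_right_mono) auto
    then show ?thesis by (simp add: u_def l_def min.coboundedI2 max.coboundedI1)
  qed
  have "u i i' \<le> l i i' \<or> u j j' \<le> l j j'"
    using assms(2) le by auto
  then have "box (l i i', l j j') (u i i', u j j') = {}"
    by (auto simp: box_eq_empty Basis_prod_def)
  moreover have "cell m i j \<inter> cell m i' j' \<subseteq> cbox (l i i', l j j') (u i i', u j j')"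
    unfolding cell_eq_cbox cbox_Pair_eq l_def u_def cbox_interval by auto
  ultimately have "negligible (cell m i j \<inter> cell m i' j')"
    by (metis negligible_interval(1) negligible_subset)
  then have "AE z in lebesgue. z \<notin> cell m i j \<inter> cell m i' j'"
    by (intro AE_not_in) (simp add: negligible_iff_null_sets)
  then show ?thesis by simp
qed

lemma unit_square_lmeasurable: "({0..1} \<times> {0..1} :: (real \<times> real) set) \<in> lmeasurable"
proof -
  have "{0..1} \<times> {0..1} = cbox (0 :: real, 0 :: real) (1, 1)"
    by (simp only: cbox_Pair_eq interval_cbox)
  then show ?thesis by simp
qed

text \<open>Additivity holds because the overlaps of the cells are null sets. It serves at two
  scales: with \<open>M\<close> for the error of the block averages, and with \<open>N\<close> for
  the sum over potential edges.\<close>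

lemma set_integral_unit_square_cells:
  fixes h :: "real \<times> real \<Rightarrow> real"
  assumes "m \<ge> 1" and h: "set_integrable lebesgue ({0..1} \<times> {0..1}) h"
  shows "(LINT z:{0..1} \<times> {0..1}|lebesgue. h z) = (\<Sum>(i, j)\<in>{1..m} \<times> {1..m}. LINT z:cell m i j|lebesgue. h z)"
proof -
  have "(LINT z:(\<Union>p\<in>{1..m} \<times> {1..m}. case p of (i, j) \<Rightarrow> cell m i j)|lebesgue. h z)
    = (\<Sum>p\<in>{1..m} \<times> {1..m}. LINT z:(case p of (i, j) \<Rightarrow> cell m i j)|lebesgue. h z)"
  proof (rule set_integral_finite_UN_AE)
    fix p q assume p: "p \<in> {1..m} \<times> {1..m}"
    have "cell m (fst p) (snd p) \<subseteq> {0..1} \<times> {0..1}"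
      using p by (intro cell_subset) auto
    then show "(case p of (i, j) \<Rightarrow> cell m i j) \<in> sets lebesgue"
      and "set_integrable lebesgue (case p of (i, j) \<Rightarrow> cell m i j) h"
      by (auto simp: case_prod_unfold intro!: set_integrable_subset[OF h])
    show "AE x in lebesgue. (x \<in> (case p of (i, j) \<Rightarrow> cell m i j) \<and> x \<in> (case q of (i, j) \<Rightarrow> cell m i j)) \<longrightarrow> p = q"
    proof (cases "p = q")
      case False
      then have "AE x in lebesgue. \<not> (x \<in> cell m (fst p) (snd p) \<and> x \<in> cell m (fst q) (snd q))"
        using assms(1) by (intro AE_cells_disjoint) (auto simp: prod_eq_iff)
      then show ?thesis
        by (rule eventually_mono) (auto simp: case_prod_unfold)
    qed simp
  qed simp
  moreover have "(\<Union>p\<in>{1..m} \<times> {1..m}. case p of (i, j) \<Rightarrow> cell m i j) = {0..1} \<times> {0..1}"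
    using Union_cell[OF assms(1)] by simp
  ultimately show ?thesis by (simp add: case_prod_unfold)
qed

section \<open>Convergence of block averages in \<open>L\<^sup>1\<close>\<close>

lemma coarsened_kernel_nonneg:
  assumes "graph_kernel K"
  shows "0 \<le> coarsened_kernel M K z"
proof -
  have "0 \<le> (LINT w:cell M i j|lebesgue. K w)" if "i \<in> {1..M}" "j \<in> {1..M}" for i j
    unfolding set_lebesgue_integral_def
    using assms cell_subset[OF that]
    by (intro Bochner_Integration.integral_nonneg) (auto simp: graph_kernel_def indicator_def)
  then show ?thesis
    unfolding coarsened_kernel_def by (intro mult_nonneg_nonneg sum_nonneg) auto
qed

lemma set_integral_const_fmeasurable:
  fixes b :: real
  assumes "C \<in> fmeasurable \<mu>"
  shows "set_integrable \<mu> C (\<lambda>x. b)" and "(LINT x:C|\<mu>. b) = b * measure \<mu> C"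
  using assms by (auto simp: set_integrable_def set_integral_const fmeasurableD fmeasurableD2 less_top[symmetric])

lemma coarsened_kernel_integrable:
  assumes "S \<in> lmeasurable"
  shows "set_integrable lebesgue S (coarsened_kernel M K)"
proof -
  have "integrable lebesgue (indicat_real (cell M i j))" for i j
    using cell_lmeasurable[of M i j] by (intro integrable_real_indicator) (auto simp: fmeasurable_def)
  then show ?thesis
    unfolding coarsened_kernel_def set_integrable_def
    by (intro integrable_mult_indicator integrable_mult_right Bochner_Integration.integrable_sum
        integrable_mult_left fmeasurableD assms)
qed

text \<open>At a point shared by several closed cells the coarsened kernel adds up the averages of
  all of them, so it equals a single cell average only almost everywhere.\<close>

lemma AE_coarsened_kernel_cell:
  assumes "i \<in> {1..M}" "j \<in> {1..M}"
  shows "AE z in lebesgue. z \<in> cell M i j \<longrightarrow>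
    coarsened_kernel M K z = (real M)\<^sup>2 * (LINT w:cell M i j|lebesgue. K w)"
proof -
  have "AE z in lebesgue. \<forall>p\<in>{1..M} \<times> {1..M} - {(i, j)}. \<not> (z \<in> cell M i j \<and> z \<in> cell M (fst p) (snd p))"
    by (subst AE_finite_all, simp, intro ballI AE_cells_disjoint) (use assms in auto)
  then show ?thesis
  proof (rule AE_mp, intro AE_I2 impI)
    fix z assume *: "\<forall>p\<in>{1..M} \<times> {1..M} - {(i, j)}. \<not> (z \<in> cell M i j \<and> z \<in> cell M (fst p) (snd p))"
      and z: "z \<in> cell M i j"
    have "(\<Sum>i=1..M. \<Sum>j=1..M. indicator (cell M i j) z * (LINT w:cell M i j|lebesgue. K w))
      = (\<Sum>p\<in>{1..M} \<times> {1..M}. indicator (cell M (fst p) (snd p)) z * (LINT w:cell M (fst p) (snd p)|lebesgue. K w))"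
      unfolding sum.cartesian_product by (simp only: case_prod_unfold)
    also have "\<dots> = (\<Sum>p\<in>{(i, j)}. indicator (cell M (fst p) (snd p)) z * (LINT w:cell M (fst p) (snd p)|lebesgue. K w))"
      by (rule sum.mono_neutral_right) (use assms * z in \<open>auto simp: indicator_def\<close>)
    finally show "coarsened_kernel M K z = (real M)\<^sup>2 * (LINT w:cell M i j|lebesgue. K w)"
      using z by (simp add: coarsened_kernel_def)
  qed
qed

text \<open>The mean \<open>A\<close> satisfies \<open>\<bar>a - A\<bar> * measure \<mu> C \<le>
  (LINT x:C|\<mu>. \<bar>f x - a\<bar>)\<close>, and the triangle inequality through
  \<open>a\<close> adds the same amount once more. Thus any convenient constant can stand in for the
  mean at the price of a factor 2.\<close>

lemma set_integral_diff_average_le: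
  fixes f :: "'a \<Rightarrow> real"
  assumes C: "C \<in> fmeasurable \<mu>" "measure \<mu> C > 0" and f: "set_integrable \<mu> C f"
  shows "(LINT x:C|\<mu>. \<bar>f x - (LINT y:C|\<mu>. f y) / measure \<mu> C\<bar>) \<le> 2 * (LINT x:C|\<mu>. \<bar>f x - a\<bar>)"
proof -
  define A where "A = (LINT y:C|\<mu>. f y) / measure \<mu> C"
  note const = set_integral_const_fmeasurable(1)[OF C(1)]
  note const_int = set_integral_const_fmeasurable(2)[OF C(1)]
  have "\<bar>a - A\<bar> * measure \<mu> C = \<bar>LINT x:C|\<mu>. a - f x\<bar>"
    using C const f by (simp add: set_integral_diff const_int A_def abs_mult[symmetric] field_simps flip: abs_of_pos)
  also have "\<dots> \<le> (LINT x:C|\<mu>. \<bar>f x - a\<bar>)"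
    unfolding set_lebesgue_integral_def
    by (rule order.trans[OF integral_abs_bound])
       (auto simp: abs_mult abs_minus_commute)
  finally have aA: "\<bar>a - A\<bar> * measure \<mu> C \<le> (LINT x:C|\<mu>. \<bar>f x - a\<bar>)" .
  have "(LINT x:C|\<mu>. \<bar>f x - A\<bar>) \<le> (LINT x:C|\<mu>. \<bar>f x - a\<bar> + \<bar>a - A\<bar>)"
    by (intro set_integral_mono set_integral_add set_integrable_abs set_integral_diff f const) auto
  also have "\<dots> = (LINT x:C|\<mu>. \<bar>f x - a\<bar>) + \<bar>a - A\<bar> * measure \<mu> C"
    by (subst set_integral_add) (auto simp: const_int intro!: set_integrable_abs set_integral_diff f const)
  finally show ?thesis using aA by (simp add: A_def)
qed

text \<open>The Euclidean distance is at most the sum of the coordinate distances, each at most the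
  side length; this is cruder than the true diameter but suffices for uniform continuity.\<close>

lemma dist_cell_le:
  assumes "z \<in> cell m i j" "w \<in> cell m i j"
  shows "dist z w \<le> 2 / real m"
proof -
  have *: "dist x y \<le> 1 / real m" if "x \<in> {(real i - 1) / real m..real i / real m}"
    "y \<in> {(real i - 1) / real m..real i / real m}" for x y :: real and i
    using that by (auto simp: dist_real_def diff_divide_distrib)
  have "dist z w \<le> dist (fst z) (fst w) + dist (snd z) (snd w)"
    unfolding dist_prod_def by (rule sqrt_sum_squares_le_sum) auto
  also have "\<dots> \<le> 1 / real m + 1 / real m"
    using assms by (intro add_mono *) (auto simp: cell_def)
  finally show ?thesis by simp
qed

text \<open>On a cell the coarsened kernel is the mean of \<open>K\<close>, so its error is at most
  twice that of the constant \<open>g z0\<close>, where \<open>g\<close> is a continuous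
  approximation of \<open>K\<close> and \<open>z0\<close> lies in the cell. Uniform continuity makes
  \<open>g\<close> nearly constant on small cells.\<close>

lemma coarsened_kernel_L1_approx:
  assumes K: "set_integrable lebesgue ({0..1} \<times> {0..1}) K" and "e > 0"
  obtains M where "M \<ge> 1" "(LINT z:{0..1} \<times> {0..1}|lebesgue. \<bar>K z - coarsened_kernel M K z\<bar>) \<le> e"
proof -
  define S :: "(real \<times> real) set" where "S = {0..1} \<times> {0..1}"
  have S: "S \<in> lmeasurable" and cS: "compact S"
    unfolding S_def by (auto intro: unit_square_lmeasurable compact_Times)
  have LS: "set_integrable lebesgue S h \<longleftrightarrow> integrable (lebesgue_on S) h"
    "(LINT z:S|lebesgue. h z) = integral\<^sup>L (lebesgue_on S) h" for h :: "real \<times> real \<Rightarrow> real"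
    using S by (simp_all add: set_integrable_def set_lebesgue_integral_def integrable_restrict_space
        integral_restrict_space fmeasurableD)
  \<comment> \<open>The distance from \<open>K\<close> to \<open>g\<close> and the oscillation of
    \<open>g\<close> on a cell are both doubled later, so each is given
    \<open>e / 4\<close>.\<close>
  obtain g where g: "continuous_on UNIV g" "set_integrable lebesgue S g"
    "(LINT z:S|lebesgue. \<bar>K z - g z\<bar>) < e / 4"
    using L1_dense_continuous[OF S, of K "e / 4"] K \<open>e > 0\<close> unfolding S_def[symmetric] LS by auto
  have "uniformly_continuous_on S g"
    using g(1) cS continuous_on_subset by (blast intro: compact_uniformly_continuous)
  then obtain d where "d > 0" and d: "\<And>z w. z \<in> S \<Longrightarrow> w \<in> S \<Longrightarrow> dist z w < d \<Longrightarrow> dist (g z) (g w) < e / 4"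
    unfolding uniformly_continuous_on_def using \<open>e > 0\<close> by (metis zero_less_divide_iff zero_less_numeral)
  \<comment> \<open>This makes the bound \<open>2 / M\<close> on distances within a cell smaller
    than \<open>d\<close>.\<close>
  obtain M where M: "2 / d < real M" using reals_Archimedean2 by blast
  then have "M > 0" using \<open>d > 0\<close> by (auto intro!: gr0I simp: divide_less_0_iff)
  then have "M \<ge> 1" by simp
  have Md: "2 / real M < d" using M \<open>M > 0\<close> \<open>d > 0\<close> by (simp add: field_simps)
  have K1: "set_integrable lebesgue S (coarsened_kernel M K)"
    by (rule coarsened_kernel_integrable[OF S])
  have KS: "set_integrable lebesgue S K" using K by (simp add: S_def)
  have cell_le: "(LINT z:cell M i j|lebesgue. \<bar>K z - coarsened_kernel M K z\<bar>)
      \<le> 2 * (LINT z:cell M i j|lebesgue. \<bar>K z - g z\<bar>) + e / 2 / (real M)\<^sup>2"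
    if ij: "i \<in> {1..M}" "j \<in> {1..M}" for i j
  proof -
    define C where "C = cell M i j"
    have C: "C \<in> lmeasurable" "C \<in> sets lebesgue" "C \<subseteq> S" and mC: "measure lebesgue C = 1 / (real M)\<^sup>2"
      using cell_subset[OF ij] measure_cell[OF \<open>M \<ge> 1\<close>] by (auto simp: C_def S_def)
    have int: "set_integrable lebesgue C K" "set_integrable lebesgue C g"
      "set_integrable lebesgue C (coarsened_kernel M K)"
      using set_integrable_subset C KS g(2) K1 by blast+
    note const = set_integral_const_fmeasurable(1)[OF C(1)]
    have const_int: "(LINT z:C|lebesgue. b) = b / (real M)\<^sup>2" for b :: real
      by (simp only: set_integral_const_fmeasurable(2)[OF C(1)] mC) simp
    \<comment> \<open>The upper right corner serves as a reference point of the cell.\<close>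
    define z0 where "z0 = (real i / real M, real j / real M)"
    have z0: "z0 \<in> C" using \<open>M \<ge> 1\<close> by (auto simp: C_def z0_def cell_def divide_right_mono)
    have gz: "\<bar>g z - g z0\<bar> \<le> e / 4" if "z \<in> C" for z
    proof -
      have "dist z z0 \<le> 2 / real M"
        using that z0 unfolding C_def by (rule dist_cell_le)
      then have "dist (g z) (g z0) < e / 4"
        using that z0 C(3) Md by (intro d) auto
      then show ?thesis by (simp add: dist_real_def)
    qed
    \<comment> \<open>The cell has measure \<open>1 / (real M)\<^sup>2\<close>, so the prefactor
      \<open>(real M)\<^sup>2\<close> of the coarsened kernel is exactly the division that forms the
      mean.\<close>
    have "(LINT z:C|lebesgue. \<bar>K z - coarsened_kernel M K z\<bar>)
      \<le> (LINT z:C|lebesgue. \<bar>K z - (LINT w:C|lebesgue. K w) / measure lebesgue C\<bar>)"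
    proof (intro set_integral_mono_AE set_integrable_abs set_integral_diff int const)
      show "AE z\<in>C in lebesgue. \<bar>K z - coarsened_kernel M K z\<bar> \<le> \<bar>K z - (LINT w:C|lebesgue. K w) / measure lebesgue C\<bar>"
        using AE_coarsened_kernel_cell[OF ij, of K] by (auto simp: mC mult.commute simp flip: C_def)
    qed
    also have "\<dots> \<le> 2 * (LINT z:C|lebesgue. \<bar>K z - g z0\<bar>)"
      by (intro set_integral_diff_average_le C int) (use \<open>M > 0\<close> in \<open>simp add: mC\<close>)
    also have "(LINT z:C|lebesgue. \<bar>K z - g z0\<bar>) \<le> (LINT z:C|lebesgue. \<bar>K z - g z\<bar> + e / 4)"
    proof (intro set_integral_mono set_integral_add set_integrable_abs set_integral_diff int const)
      show "\<bar>K z - g z0\<bar> \<le> \<bar>K z - g z\<bar> + e / 4" if "z \<in> C" for z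
        using gz[OF that] by linarith
    qed
    also have "\<dots> = (LINT z:C|lebesgue. \<bar>K z - g z\<bar>) + e / 4 / (real M)\<^sup>2"
      by (subst set_integral_add) (auto simp only: const_int intro!: set_integrable_abs set_integral_diff int const)
    finally show ?thesis by (simp add: C_def field_simps)
  qed
  have "(LINT z:S|lebesgue. \<bar>K z - coarsened_kernel M K z\<bar>)
    = (\<Sum>(i, j)\<in>{1..M} \<times> {1..M}. LINT z:cell M i j|lebesgue. \<bar>K z - coarsened_kernel M K z\<bar>)"
    unfolding S_def
    by (intro set_integral_unit_square_cells \<open>M \<ge> 1\<close> set_integrable_abs set_integral_diff K K1[unfolded S_def])
  also have "\<dots> \<le> (\<Sum>(i, j)\<in>{1..M} \<times> {1..M}. 2 * (LINT z:cell M i j|lebesgue. \<bar>K z - g z\<bar>) + e / 2 / (real M)\<^sup>2)"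
    using cell_le by (intro sum_mono) auto
  \<comment> \<open>There are \<open>M * M\<close> cells, so the oscillation terms add up to
    \<open>e / 2\<close>.\<close>
  also have "\<dots> = 2 * (\<Sum>(i, j)\<in>{1..M} \<times> {1..M}. LINT z:cell M i j|lebesgue. \<bar>K z - g z\<bar>) + e / 2"
    using \<open>M > 0\<close> by (simp add: case_prod_unfold sum.distrib sum_distrib_left power2_eq_square)
  also have "(\<Sum>(i, j)\<in>{1..M} \<times> {1..M}. LINT z:cell M i j|lebesgue. \<bar>K z - g z\<bar>) = (LINT z:S|lebesgue. \<bar>K z - g z\<bar>)"
    unfolding S_def
    by (intro set_integral_unit_square_cells[symmetric] \<open>M \<ge> 1\<close> set_integrable_abs set_integral_diff K g(2)[unfolded S_def])
  also have "2 * \<dots> + e / 2 \<le> e" using g(3) by simp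
  finally show ?thesis using that \<open>M \<ge> 1\<close> by (simp add: S_def)
qed

section \<open>Edge probabilities and the \<open>L\<^sup>1\<close> distance of kernels\<close>

lemma edge_prob_nonneg:
  assumes "c > 0" "(i, j) \<in> vertex_pairs N"
    and "\<And>z. z \<in> {0..1} \<times> {0..1} \<Longrightarrow> 0 \<le> L z"
  shows "0 \<le> edge_prob c L N i j"
proof -
  have "cell N i j \<subseteq> {0..1} \<times> {0..1}"
    using assms(2) by (intro cell_subset) (auto simp: vertex_pairs_def)
  then have "0 \<le> (LINT z:cell N i j|lebesgue. L z)"
    unfolding set_lebesgue_integral_def
    using assms(3) by (intro Bochner_Integration.integral_nonneg) (auto simp: indicator_def)
  then show ?thesis
    using assms(1) by (simp add: edge_prob_def cell_average_def)
qed

lemma edge_prob_diff_le: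
  assumes "c > 0" "set_integrable lebesgue (cell N i j) K" "set_integrable lebesgue (cell N i j) L"
  shows "\<bar>edge_prob c K N i j - edge_prob c L N i j\<bar> \<le> c * real N * (LINT z:cell N i j|lebesgue. \<bar>K z - L z\<bar>)"
proof -
  have "\<bar>edge_prob c K N i j - edge_prob c L N i j\<bar>
    \<le> \<bar>c * cell_average K N i j / real N - c * cell_average L N i j / real N\<bar>"
    unfolding edge_prob_def by linarith
  also have "\<dots> = c * real N * \<bar>LINT z:cell N i j|lebesgue. K z - L z\<bar>"
  proof -
    have "c * cell_average K N i j / real N - c * cell_average L N i j / real N
      = c * real N * (LINT z:cell N i j|lebesgue. K z - L z)"
      by (simp add: cell_average_def set_integral_diff(2)[OF assms(2,3)] power2_eq_square algebra_simps)
    then show ?thesis using assms(1) by (simp add: abs_mult)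
  qed
  also have "\<bar>LINT z:cell N i j|lebesgue. K z - L z\<bar> \<le> (LINT z:cell N i j|lebesgue. \<bar>K z - L z\<bar>)"
    unfolding set_lebesgue_integral_def
    by (rule order.trans[OF integral_abs_bound]) (simp add: abs_mult)
  finally show ?thesis using assms(1) by (simp add: mult_left_mono)
qed

text \<open>Passing from increasing pairs to all ordered pairs, the diagonal included, only adds
  nonnegative terms, and the cells then cover the whole square.\<close>

lemma sum_edge_prob_diff_le:
  assumes "c > 0" "N \<ge> 1"
    and K: "set_integrable lebesgue ({0..1} \<times> {0..1}) K" and L: "set_integrable lebesgue ({0..1} \<times> {0..1}) L"
  shows "(\<Sum>(i, j)\<in>vertex_pairs N. \<bar>edge_prob c K N i j - edge_prob c L N i j\<bar>)
    \<le> c * real N * (LINT z:{0..1} \<times> {0..1}|lebesgue. \<bar>K z - L z\<bar>)"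
proof -
  have "(\<Sum>(i, j)\<in>vertex_pairs N. \<bar>edge_prob c K N i j - edge_prob c L N i j\<bar>)
    \<le> (\<Sum>(i, j)\<in>{1..N} \<times> {1..N}. \<bar>edge_prob c K N i j - edge_prob c L N i j\<bar>)"
    by (rule sum_mono2) (auto simp: vertex_pairs_def)
  also have "\<dots> \<le> (\<Sum>(i, j)\<in>{1..N} \<times> {1..N}. c * real N * (LINT z:cell N i j|lebesgue. \<bar>K z - L z\<bar>))"
  proof (intro sum_mono, clarify)
    fix i j assume "i \<in> {1..N}" "j \<in> {1..N}"
    then have "cell N i j \<subseteq> {0..1} \<times> {0..1}" by (rule cell_subset)
    then show "\<bar>edge_prob c K N i j - edge_prob c L N i j\<bar> \<le> c * real N * (LINT z:cell N i j|lebesgue. \<bar>K z - L z\<bar>)"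
      by (intro edge_prob_diff_le assms(1) set_integrable_subset[OF K] set_integrable_subset[OF L]) auto
  qed
  also have "\<dots> = c * real N * (\<Sum>(i, j)\<in>{1..N} \<times> {1..N}. LINT z:cell N i j|lebesgue. \<bar>K z - L z\<bar>)"
    by (simp add: case_prod_unfold sum_distrib_left)
  also have "\<dots> = c * real N * (LINT z:{0..1} \<times> {0..1}|lebesgue. \<bar>K z - L z\<bar>)"
    by (subst set_integral_unit_square_cells[OF assms(2)]) (auto intro!: set_integrable_abs set_integral_diff K L)
  finally show ?thesis .
qed

theorem lemma4:
  fixes \<kappa> :: nat and K :: "real \<times> real \<Rightarrow> real" and c \<delta> :: real
  assumes "\<kappa> \<ge> 2"
    and "graph_kernel K"
    and "c > 0"
    and "0 < \<delta>" and "\<delta> < 1 / 2"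
  shows "\<exists>M::nat\<ge>1. \<forall>\<^sub>F N in sequentially.
    \<bar>measure_pmf.expectation (random_graph c K N) (\<lambda>G. max_cut \<kappa> N G / real N)
      - measure_pmf.expectation (random_graph c (coarsened_kernel M K) N) (\<lambda>G. max_cut \<kappa> N G / real N)\<bar>
    \<le> c powr (1 / 2 - \<delta>)"
proof -
  have K: "set_integrable lebesgue ({0..1} \<times> {0..1}) K" and K0: "\<And>z. z \<in> {0..1} \<times> {0..1} \<Longrightarrow> 0 \<le> K z"
    using assms(2) by (auto simp: graph_kernel_def)
  \<comment> \<open>The tolerance is the target divided by \<open>c\<close>, since the comparison of
    expectations multiplies the \<open>L\<^sup>1\<close> distance by \<open>c\<close>. This fixes
    \<open>M\<close> before \<open>N\<close> is introduced.\<close>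
  obtain M where "M \<ge> 1"
    and M: "(LINT z:{0..1} \<times> {0..1}|lebesgue. \<bar>K z - coarsened_kernel M K z\<bar>) \<le> c powr (1 / 2 - \<delta>) / c"
    using coarsened_kernel_L1_approx[OF K, of "c powr (1 / 2 - \<delta>) / c"] \<open>c > 0\<close> by auto
  have K1: "set_integrable lebesgue ({0..1} \<times> {0..1}) (coarsened_kernel M K)"
    by (intro coarsened_kernel_integrable unit_square_lmeasurable)
  have "\<bar>measure_pmf.expectation (random_graph c K N) (\<lambda>G. max_cut \<kappa> N G / real N)
      - measure_pmf.expectation (random_graph c (coarsened_kernel M K) N) (\<lambda>G. max_cut \<kappa> N G / real N)\<bar>
    \<le> c powr (1 / 2 - \<delta>)" if "N \<ge> 1" for N
  proof -
    have "\<bar>measure_pmf.expectation (random_graph c K N) (\<lambda>G. max_cut \<kappa> N G / real N)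
        - measure_pmf.expectation (random_graph c (coarsened_kernel M K) N) (\<lambda>G. max_cut \<kappa> N G / real N)\<bar>
      \<le> 1 / real N * (\<Sum>(i, j)\<in>vertex_pairs N. \<bar>edge_prob c K N i j - edge_prob c (coarsened_kernel M K) N i j\<bar>)"
      by (rule expectation_max_cut_diff_le)
         (use assms(1,3) K0 coarsened_kernel_nonneg[OF assms(2)] in \<open>auto intro: edge_prob_nonneg\<close>)
    \<comment> \<open>The factor \<open>N\<close> from the edge probabilities cancels the
      normalisation \<open>1 / N\<close>, which makes the estimate uniform over all
      \<open>N \<ge> 1\<close>.\<close>
    also have "\<dots> \<le> 1 / real N * (c * real N * (LINT z:{0..1} \<times> {0..1}|lebesgue. \<bar>K z - coarsened_kernel M K z\<bar>))"
      by (intro mult_left_mono sum_edge_prob_diff_le assms(3) that K K1) simp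
    also have "\<dots> = c * (LINT z:{0..1} \<times> {0..1}|lebesgue. \<bar>K z - coarsened_kernel M K z\<bar>)"
      using that by simp
    also have "\<dots> \<le> c * (c powr (1 / 2 - \<delta>) / c)"
      using M \<open>c > 0\<close> by (intro mult_left_mono) auto
    finally show ?thesis using \<open>c > 0\<close> by simp
  qed
  then show ?thesis
    using \<open>M \<ge> 1\<close> eventually_sequentially by blast
qed

end
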